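(* Let $X^*\in\mathbb R^{n_1\times n_2}$ have rank $r$, let $\mathcal A:\mathbb R^{n_1\times n_2}\to\mathbb R^m$ be a linear map satisfying a $2r$-RIP with constant $\delta_{2r}<1$, and let $b=\mathcal A(X^* )$. Let $U_t\in\mathbb R^{n_1\times r}$ and $V_t\in\mathbb R^{n_2\times r}$ have full column rank, and let $X_t=U_tV_t^\top$. Let $(\Delta U_t,\Delta V_t)$ be the minimal norm solution of $$\min_{\Delta U,\Delta V}\|\mathcal A(U_tV_t^\top+U_t\Delta V^\top+\Delta U\,V_t^\top)-b\|^2,$$ and let $U_{t+1}=U_t+\Delta U_t$, $V_{t+1}=V_t+\Delta V_t$. Then $$\|U_{t+1}^\top U_{t+1}-V_{t+1}^\top V_{t+1}\|_F\le\|U_t^\top U_t-V_t^\top V_t\|_F+\frac{1+\delta_{2r}}{1-\delta_{2r}}\,\frac{\|X_t-X^*\|_F^2}{\min\{\sigma_r^2(U_t),\sigma_r^2(V_t)\}}.$$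
   Context: $\sigma_i(\cdot)$ is the $i$-th largest singular value; $\|\cdot\|_F$ the Frobenius norm, $\|\cdot\|$ the Euclidean norm. RIP: $\mathcal A$ satisfies a $k$-RIP with constant $\delta_k\in[0,1)$ if $(1-\delta_k)\|X\|_F^2\le\|\mathcal A(X)\|^2\le(1+\delta_k)\|X\|_F^2$ for all $X$ of rank at most $k$. The minimal norm solution of the least squares problem is the minimizer $(\Delta U,\Delta V)\in\mathbb R^{n_1\times r}\times\mathbb R^{n_2\times r}$ with smallest $\|\Delta U\|_F^2+\|\Delta V\|_F^2$. *)

theory Defs
  imports "HOL-Analysis.Analysis" "HOL-Computational_Algebra.Polynomial"
begin

text \<open>An \<open>m \<times> n\<close> real matrix is an element of \<open>real ^ 'n ^ 'm\<close>. The library norm on this type is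
  the \<open>L2\<close> norm of the \<open>L2\<close> norms of the rows, i.e. the Frobenius norm (on \<open>real ^ 'm\<close> it is the
  Euclidean norm). As index types are nonempty, all dimensions are at least 1.\<close>

lemma norm_matrix_frobenius:
  fixes X :: "real ^ 'n ^ 'm"
  shows "norm X = sqrt (\<Sum>i\<in>UNIV. \<Sum>j\<in>UNIV. (X $ i $ j)\<^sup>2)"
  by (simp add: norm_vec_def L2_set_def sum_nonneg)

text \<open>\<open>charpoly S = det (x I - S)\<close>, the determinant being taken over the polynomial ring.\<close>

definition charpoly :: "real ^ 'n ^ 'n \<Rightarrow> real poly" where
  "charpoly S = det (mat [:0, 1:] - (\<chi> i j. [:S $ i $ j:]))"

text \<open>\<open>singular_value i X\<close> is the \<open>i\<close>-th largest singular value, counted from \<open>i = 1\<close>: the square root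
  of the \<open>i\<close>-th largest eigenvalue, with multiplicity, of \<open>X\<^sup>T X\<close>. It is meaningful for \<open>i\<close> between 1
  and the number of columns of \<open>X\<close>.\<close>

definition singular_value :: "nat \<Rightarrow> real ^ 'n ^ 'm \<Rightarrow> real" where
  "singular_value i X =
     sqrt (rev (sorted_list_of_multiset (proots (charpoly (transpose X ** X)))) ! (i - 1))"

definition RIP :: "nat \<Rightarrow> real \<Rightarrow> (real ^ 'n ^ 'm \<Rightarrow> real ^ 'p) \<Rightarrow> bool" where
  "RIP k \<delta> \<A> \<longleftrightarrow> 0 \<le> \<delta> \<and> \<delta> < 1 \<and>
     (\<forall>X. rank X \<le> k \<longrightarrow>
        (1 - \<delta>) * (norm X)\<^sup>2 \<le> (norm (\<A> X))\<^sup>2 \<and> (norm (\<A> X))\<^sup>2 \<le> (1 + \<delta>) * (norm X)\<^sup>2)"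

definition lsq_objective ::
  "(real ^ 'n2 ^ 'n1 \<Rightarrow> real ^ 'm) \<Rightarrow> real ^ 'm \<Rightarrow> real ^ 'r ^ 'n1 \<Rightarrow> real ^ 'r ^ 'n2 \<Rightarrow>
   (real ^ 'r ^ 'n1) \<times> (real ^ 'r ^ 'n2) \<Rightarrow> real" where
  "lsq_objective \<A> b U V =
     (\<lambda>(\<Delta>U, \<Delta>V).
        (norm (\<A> (U ** transpose V + U ** transpose \<Delta>V + \<Delta>U ** transpose V) - b))\<^sup>2)"

definition min_norm_lsq_solution ::
  "(real ^ 'n2 ^ 'n1 \<Rightarrow> real ^ 'm) \<Rightarrow> real ^ 'm \<Rightarrow> real ^ 'r ^ 'n1 \<Rightarrow> real ^ 'r ^ 'n2 \<Rightarrow>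
   (real ^ 'r ^ 'n1) \<times> (real ^ 'r ^ 'n2) \<Rightarrow> bool" where
  "min_norm_lsq_solution \<A> b U V =
     is_arg_min (\<lambda>(\<Delta>U, \<Delta>V). (norm \<Delta>U)\<^sup>2 + (norm \<Delta>V)\<^sup>2)
       (is_arg_min (lsq_objective \<A> b U V) (\<lambda>_. True))"

end

theory Submission
  imports Defs
begin

text \<open>
  Perturbing a minimal norm solution along the directions \<open>(U W, - V W\<^sup>T)\<close>, which do not change
  \<open>L = U \<Delta>V\<^sup>T + \<Delta>U V\<^sup>T\<close>, gives \<open>U\<^sup>T \<Delta>U = \<Delta>V\<^sup>T V\<close>. Hence the terms of first order in the step cancel
  in \<open>U'\<^sup>T U' - V'\<^sup>T V'\<close>, and what remains is \<open>\<Delta>U\<^sup>T \<Delta>U - \<Delta>V\<^sup>T \<Delta>V\<close>, of norm at most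
  \<open>\<parallel>\<Delta>U\<parallel>\<^sup>2 + \<parallel>\<Delta>V\<parallel>\<^sup>2\<close>. The same identity makes the inner product of the two summands of \<open>L\<close>
  equal to \<open>\<parallel>U\<^sup>T \<Delta>U\<parallel>\<^sup>2 \<ge> 0\<close>, so \<open>\<parallel>L\<parallel>\<^sup>2\<close> dominates \<open>\<parallel>\<Delta>U\<parallel>\<^sup>2 + \<parallel>\<Delta>V\<parallel>\<^sup>2\<close> times the smaller squared
  \<open>r\<close>-th singular value. Finally, \<open>- \<A> L\<close> is the orthogonal projection of \<open>\<A> (X - X\<^sup>*)\<close> onto a
  subspace, and the RIP turns this into a bound on \<open>\<parallel>L\<parallel>\<close>.
\<close>

section \<open>First-order conditions for quadratic functions of one variable\<close>

text \<open>The quadratic vanishes at \<open>t = 0\<close>, so nonnegativity makes 0 a minimum,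
  where the derivative \<open>2 * a\<close> must be zero. The Rayleigh quotient, the least squares
  residual and the minimal norm condition are all handled this way.\<close>

lemma linear_coeff_zero_if_quadratic_nonneg:
  fixes a c :: real
  assumes "\<And>t. 0 \<le> 2 * t * a + t\<^sup>2 * c"
  shows "a = 0"
proof (rule ccontr)
  assume "a \<noteq> 0"
  \<comment> \<open>This \<open>k\<close> is positive and exceeds \<open>c / 2\<close> whatever the
    sign of \<open>c\<close>, so the quadratic is negative at \<open>t = - a / k\<close>.\<close>
  define k where "k = 1 + \<bar>c\<bar>"
  have k: "k > 0" "c < 2 * k"
    unfolding k_def by auto
  have "0 \<le> 2 * (- a / k) * a + (- a / k)\<^sup>2 * c"
    by (rule assms)
  also have "\<dots> = (a / k)\<^sup>2 * (c - 2 * k)"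
    using k(1) by (simp add: field_simps power2_eq_square)
  also have "\<dots> < 0"
    using \<open>a \<noteq> 0\<close> k by (intro mult_pos_neg) auto
  finally show False
    by simp
qed

lemma norm_add_scaleR_sq:
  fixes x y :: "'a::real_inner"
  shows "(norm (x + t *\<^sub>R y))\<^sup>2 = (norm x)\<^sup>2 + 2 * t * (x \<bullet> y) + t\<^sup>2 * (norm y)\<^sup>2"
  unfolding power2_norm_eq_inner
  by (simp add: inner_add_left inner_add_right algebra_simps inner_commute power2_eq_square)

lemma norm_vec_sq: "(norm (x :: real ^ 'n))\<^sup>2 = (\<Sum>i\<in>UNIV. (x $ i)\<^sup>2)"
  unfolding power2_norm_eq_inner inner_vec_def by (simp add: power2_eq_square)

section \<open>Spectral theorem for real symmetric matrices\<close>

text \<open>A minimiser of the Rayleigh quotient on the unit sphere of \<open>S\<close> is an eigenvector.\<close>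

lemma symmetric_eigenvector_exists:
  fixes f :: "'a::euclidean_space \<Rightarrow> 'a"
  assumes lin: "linear f" and sym: "\<And>x y. f x \<bullet> y = x \<bullet> f y"
    and S: "subspace S" "f ` S \<subseteq> S" "S \<noteq> {0}"
  obtains v l where "v \<in> S" "norm v = 1" "f v = l *\<^sub>R v"
proof -
  interpret linear f by fact
  obtain w where w: "w \<in> S" "w \<noteq> 0"
    using S(1,3) subspace_0 by blast
  let ?K = "sphere 0 1 \<inter> S"
  have "compact ?K"
    using S(1) by (intro compact_Int_closed closed_subspace) auto
  moreover have "w /\<^sub>R norm w \<in> ?K"
    using w S(1) by (auto simp: subspace_scale)
  moreover have "continuous_on ?K (\<lambda>x. f x \<bullet> x)"
    using lin by (intro continuous_intros linear_continuous_on linear_conv_bounded_linear[THEN iffD1])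
  ultimately obtain v where v: "v \<in> ?K" and min: "\<And>y. y \<in> ?K \<Longrightarrow> f v \<bullet> v \<le> f y \<bullet> y"
    using continuous_attains_inf[of ?K "\<lambda>x. f x \<bullet> x"] by blast
  define l where "l = f v \<bullet> v"
  have vS: "v \<in> S" "norm v = 1" and vv: "v \<bullet> v = 1"
    using v by (auto simp: norm_eq_1)
  have ray: "l * (y \<bullet> y) \<le> f y \<bullet> y" if "y \<in> S" for y
  proof (cases "y = 0")
    case False
    have "y /\<^sub>R norm y \<in> ?K"
      using that False S(1) by (auto simp: subspace_scale)
    then have "l \<le> f (y /\<^sub>R norm y) \<bullet> (y /\<^sub>R norm y)"
      unfolding l_def by (rule min)
    also have "\<dots> = f y \<bullet> y / (norm y)\<^sup>2"
      by (simp add: scale power2_eq_square divide_simps)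
    finally show ?thesis
      using False by (simp add: field_simps power2_norm_eq_inner)
  qed simp
  \<comment> \<open>The component of \<open>f v\<close> orthogonal to \<open>v\<close>. Perturbing
    the minimiser in this direction gives the linear coefficient \<open>u \<bullet> u\<close>, so
    stationarity forces \<open>u = 0\<close>.\<close>
  define u where "u = f v - l *\<^sub>R v"
  have uS: "u \<in> S"
    unfolding u_def using S vS by (auto intro!: subspace_diff subspace_scale)
  have "0 \<le> 2 * t * (u \<bullet> u) + t\<^sup>2 * (f u \<bullet> u - l * (u \<bullet> u))" for t
  proof -
    have "v + t *\<^sub>R u \<in> S"
      using S(1) uS vS by (auto intro!: subspace_add subspace_scale)
    then have "0 \<le> f (v + t *\<^sub>R u) \<bullet> (v + t *\<^sub>R u) - l * ((v + t *\<^sub>R u) \<bullet> (v + t *\<^sub>R u))"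
      using ray by auto
    also have "\<dots> = 2 * t * (f v \<bullet> u - l * (v \<bullet> u)) + t\<^sup>2 * (f u \<bullet> u - l * (u \<bullet> u))"
      using sym[of u v] vv l_def[symmetric]
      by (simp add: add scale inner_add_left inner_add_right algebra_simps inner_commute power2_eq_square)
    also have "f v \<bullet> u - l * (v \<bullet> u) = u \<bullet> u"
    proof -
      have "u \<bullet> v = 0"
        by (simp add: u_def inner_diff_left vv l_def)
      then show ?thesis
        by (subst (3) u_def) (simp add: inner_diff_left)
    qed
    finally show ?thesis .
  qed
  then have "u \<bullet> u = 0"
    by (rule linear_coeff_zero_if_quadratic_nonneg)
  then have "f v = l *\<^sub>R v"
    by (simp add: u_def)
  with vS that show thesis
    by blast
qed

text \<open>An orthonormal family of eigenvectors of largest cardinality works: by symmetry its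
  orthogonal complement is invariant under \<open>f\<close>, so a nonzero complement would contain
  one more eigenvector.\<close>

lemma symmetric_eigenbasis_exists:
  fixes f :: "'a::euclidean_space \<Rightarrow> 'a"
  assumes lin: "linear f" and sym: "\<And>x y. f x \<bullet> y = x \<bullet> f y"
  obtains B where "pairwise orthogonal B" "\<And>b. b \<in> B \<Longrightarrow> norm b = 1"
    "\<And>b. b \<in> B \<Longrightarrow> \<exists>l. f b = l *\<^sub>R b" "finite B" "card B = DIM('a)"
proof -
  define P where "P B \<longleftrightarrow> pairwise orthogonal B \<and> (\<forall>b\<in>B. norm b = 1 \<and> (\<exists>l. f b = l *\<^sub>R b))"
    for B
  have indep: "independent B" if "P B" for B
    using that unfolding P_def by (intro pairwise_orthogonal_independent) auto
  then have bnd: "finite B \<and> card B \<le> DIM('a)" if "P B" for B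
    using that independent_bound by blast
  have "P {}"
    by (simp add: P_def)
  \<comment> \<open>Independence bounds the cardinality of such families by the dimension, so a
    largest one exists.\<close>
  then obtain B where B: "P B" and max: "\<And>C. P C \<Longrightarrow> card C \<le> card B"
    using ex_has_greatest_nat[of P "{}" card "DIM('a) + 1"] bnd by fastforce
  define W where "W = {y. \<forall>b\<in>B. orthogonal b y}"
  have W: "subspace W"
    unfolding W_def by (rule subspace_orthogonal_to_vectors)
  have inv: "f ` W \<subseteq> W"
  proof
    fix z assume "z \<in> f ` W"
    then obtain y where y: "z = f y" "y \<in> W"
      by blast
    have "orthogonal b (f y)" if b: "b \<in> B" for b
    proof -
      obtain l where "f b = l *\<^sub>R b"
        using B b unfolding P_def by blast
      then show ?thesis
        using y(2) b sym[of b y] by (simp add: W_def orthogonal_def)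
    qed
    then show "z \<in> W"
      by (simp add: W_def y)
  qed
  have "W = {0}"
  proof (rule ccontr)
    assume "W \<noteq> {0}"
    then obtain v l where v: "v \<in> W" "norm v = 1" "f v = l *\<^sub>R v"
      using symmetric_eigenvector_exists[OF lin sym W inv] by blast
    have "v \<notin> B"
      using v by (auto simp: W_def orthogonal_def)
    have "P (insert v B)"
      using B v by (auto simp: P_def pairwise_insert W_def orthogonal_commute)
    then have "card (insert v B) \<le> card B"
      by (rule max)
    then show False
      using \<open>v \<notin> B\<close> bnd[OF B] by simp
  qed
  have "span B = UNIV"
  proof (rule ccontr)
    assume "span B \<noteq> UNIV"
    then have "span B \<subset> span UNIV"
      by auto
    then obtain x where "x \<noteq> 0" "\<And>y. y \<in> span B \<Longrightarrow> orthogonal x y"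
      using orthogonal_to_subspace_exists_gen by metis
    then show False
      using \<open>W = {0}\<close> by (auto simp: W_def orthogonal_commute span_base)
  qed
  then have "card B = DIM('a)"
    using indep[OF B] by (metis dim_UNIV dim_eq_card_independent dim_span)
  then show thesis
    using that B bnd[OF B] unfolding P_def by blast
qed

text \<open>The columns of \<open>Q\<close> are an orthonormal eigenbasis, enumerated by the index
  type itself through a bijection.\<close>

lemma symmetric_matrix_diagonalization:
  fixes S :: "real ^ 'n ^ 'n"
  assumes "transpose S = S"
  obtains Q :: "real ^ 'n ^ 'n" and d :: "'n \<Rightarrow> real"
  where "orthogonal_matrix Q" "S ** Q = Q ** (\<chi> i j. if i = j then d i else 0)"
proof -
  have "(S *v x) \<bullet> y = x \<bullet> (S *v y)" for x y
    using assms by (metis dot_lmul_matrix transpose_matrix_vector)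
  then obtain B where B: "pairwise orthogonal B" "\<And>b. b \<in> B \<Longrightarrow> norm b = 1"
      "\<And>b. b \<in> B \<Longrightarrow> \<exists>l. S *v b = l *\<^sub>R b" "finite B" "card B = CARD('n)"
    using symmetric_eigenbasis_exists[of "(*v) S"] by auto
  then obtain q where q: "bij_betw q (UNIV :: 'n set) B"
    using finite_same_card_bij[of "UNIV :: 'n set" B] by auto
  then have qB: "q i \<in> B" for i
    by (auto simp: bij_betw_def)
  then have "\<forall>i. \<exists>l. S *v q i = l *\<^sub>R q i"
    using B(3) by blast
  then obtain d where d: "\<And>i. S *v q i = d i *\<^sub>R q i"
    by metis
  define Q where "Q = (\<chi> i j. q j $ i)"
  have col: "column j Q = q j" for j
    by (simp add: column_def Q_def vec_eq_iff)
  have "orthogonal (q i) (q j)" if "i \<noteq> j" for i j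
  proof (rule pairwiseD[OF B(1) qB qB])
    show "q i \<noteq> q j"
      using q that by (auto simp: bij_betw_def dest: injD)
  qed
  then have "orthogonal_matrix Q"
    by (simp add: orthogonal_matrix_orthonormal_columns col B(2) qB)
  moreover have "S ** Q = Q ** (\<chi> i j. if i = j then d i else 0)"
  proof -
    have "(S ** Q) $ i $ j = (S *v q j) $ i" for i j
      by (simp add: matrix_matrix_mult_def matrix_vector_mult_def Q_def)
    moreover have "(Q ** (\<chi> i j. if i = j then d i else 0)) $ i $ j = d j * q j $ i" for i j
      by (simp add: matrix_matrix_mult_def Q_def if_distrib[of "\<lambda>u. _ * u"] cong: if_cong)
    ultimately show ?thesis
      by (simp add: d vec_eq_iff)
  qed
  ultimately show thesis
    by (rule that)
qed

section \<open>Characteristic polynomial and smallest singular value\<close>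

lemma poly_charpoly: "poly (charpoly S) x = det (mat x - S)"
proof -
  have "poly (mat [:0, 1:] $ i $ j - [:S $ i $ j:]) x = (mat x - S) $ i $ j" for i j
    by (simp add: mat_def)
  then show ?thesis
    by (simp add: charpoly_def det_def poly_sum poly_prod)
qed

text \<open>Scalar matrices commute with \<open>Q\<close>, so at every real \<open>x\<close> the
  nonzero factor \<open>det Q\<close> cancels and leaves the determinant of a diagonal matrix. Real
  polynomials that agree at all points are equal.\<close>

lemma charpoly_diagonalization:
  fixes S :: "real ^ 'n ^ 'n"
  assumes Q: "orthogonal_matrix Q" and SQ: "S ** Q = Q ** (\<chi> i j. if i = j then d i else 0)"
  shows "charpoly S = (\<Prod>i\<in>UNIV. [:- d i, 1:])"
proof -
  let ?D = "(\<chi> i j. if i = j then d i else 0) :: real ^ 'n ^ 'n"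
  have "poly (charpoly S) x = poly (\<Prod>i\<in>UNIV. [:- d i, 1:]) x" for x
  proof -
    have mat: "mat x ** Q = Q ** mat x"
      by (simp add: vec_eq_iff matrix_matrix_mult_def mat_def if_distrib[of "\<lambda>u. u * _"]
          if_distrib[of "\<lambda>u. _ * u"] cong: if_cong)
    have "(mat x - S) ** Q = Q ** (mat x - ?D)"
      using mat SQ
      by (simp add: vec_eq_iff matrix_matrix_mult_def algebra_simps sum_subtractf)
    then have "det ((mat x - S) ** Q) = det (Q ** (mat x - ?D))"
      by simp
    then have "det (mat x - S) * det Q = det Q * det (mat x - ?D)"
      unfolding det_mul .
    moreover have "det Q \<noteq> 0"
      using det_orthogonal_matrix[OF Q] by auto
    ultimately have "det (mat x - S) = det (mat x - ?D)"
      by simp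
    also have "\<dots> = (\<Prod>i\<in>UNIV. x - d i)"
      by (subst det_diagonal) (auto simp: mat_def)
    finally show ?thesis
      by (simp add: poly_charpoly poly_prod)
  qed
  then show ?thesis
    by (simp add: poly_eq_poly_eq_iff[symmetric] fun_eq_iff)
qed

text \<open>Connects the definition through roots of \<open>charpoly\<close> with the
  diagonalization: the roots, with multiplicity, are the diagonal entries \<open>d\<close>.\<close>

lemma last_singular_value:
  fixes X :: "real ^ 'r ^ 'm"
  obtains Q :: "real ^ 'r ^ 'r" and d :: "'r \<Rightarrow> real"
  where "orthogonal_matrix Q"
    "transpose X ** X ** Q = Q ** (\<chi> i j. if i = j then d i else 0)"
    "singular_value CARD('r) X = sqrt (Min (range d))"
proof -
  let ?S = "transpose X ** X"
  have "transpose ?S = ?S"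
    by (simp add: matrix_transpose_mul)
  then obtain Q d where Q: "orthogonal_matrix Q"
      and SQ: "?S ** Q = Q ** (\<chi> i j. if i = j then d i else 0)"
    using symmetric_matrix_diagonalization by blast
  have "charpoly ?S = (\<Prod>i\<in>UNIV. [:- d i, 1:])"
    using charpoly_diagonalization[OF Q SQ] .
  then have roots: "proots (charpoly ?S) = image_mset d (mset_set UNIV)"
    by (simp add: proots_prod sum_unfold_sum_mset)
  define xs where "xs = sorted_list_of_multiset (image_mset d (mset_set UNIV))"
  have xs: "sorted xs" "set xs = range d" "length xs = CARD('r)"
    unfolding xs_def
    by (simp_all flip: set_mset_mset size_mset)
  then have "xs \<noteq> []"
    by auto
  \<comment> \<open>The reversed list is descending and indexed from 0, so the singular value
    numbered \<open>CARD('r)\<close> comes from its last entry, the head of the ascending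
    list.\<close>
  have "rev xs ! (CARD('r) - 1) = xs ! 0"
    using xs(3) by (simp add: rev_nth)
  also have "\<dots> = Min (set xs)"
    using xs(1) \<open>xs \<noteq> []\<close> by (cases xs) (auto intro!: Min_eqI[symmetric])
  finally have "singular_value CARD('r) X = sqrt (Min (range d))"
    unfolding singular_value_def roots xs_def[symmetric] xs(2) by simp
  with Q SQ show thesis
    by (rule that)
qed

lemma norm_matrix_vector_mult_sq:
  fixes X :: "real ^ 'r ^ 'm"
  shows "(norm (X *v x))\<^sup>2 = x \<bullet> ((transpose X ** X) *v x)"
  using dot_lmul_matrix[of x "transpose X" "X *v x"]
  by (simp only: power2_norm_eq_inner matrix_vector_mul_assoc vector_transpose_matrix)

text \<open>In the eigenbasis coordinates \<open>y\<close> of \<open>x\<close>, the squared norm of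
  \<open>X *v x\<close> is the sum of \<open>d i * (y $ i)\<^sup>2\<close>, which is at least the
  smallest \<open>d i\<close> times the squared norm of \<open>y\<close>.\<close>

lemma singular_value_bound_pos:
  fixes X :: "real ^ 'r ^ 'm"
  assumes "rank X = CARD('r)"
  shows "0 < (singular_value CARD('r) X)\<^sup>2"
    and "(singular_value CARD('r) X)\<^sup>2 * (norm x)\<^sup>2 \<le> (norm (X *v x))\<^sup>2"
proof -
  obtain Q d where Q: "orthogonal_matrix Q"
      and SQ: "transpose X ** X ** Q = Q ** (\<chi> i j. if i = j then d i else 0)"
      and sv: "singular_value CARD('r) X = sqrt (Min (range d))"
    using last_singular_value .
  have QQ: "transpose Q ** Q = mat 1" "Q ** transpose Q = mat 1"
    using Q by (auto simp: orthogonal_matrix_def)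
  have expand: "(norm (X *v (Q *v y)))\<^sup>2 = (\<Sum>i\<in>UNIV. d i * (y $ i)\<^sup>2)" for y
  proof -
    let ?D = "(\<chi> i j. if i = j then d i else 0) :: real ^ 'r ^ 'r"
    have "(norm (X *v (Q *v y)))\<^sup>2 = (Q *v y) \<bullet> ((Q ** ?D) *v y)"
      unfolding norm_matrix_vector_mult_sq
      unfolding matrix_vector_mul_assoc[of "transpose X ** X" Q] SQ ..
    also have "\<dots> = y \<bullet> ((transpose Q ** Q) *v (?D *v y))"
      using dot_lmul_matrix[of y "transpose Q" "(Q ** ?D) *v y"]
      by (simp only: matrix_vector_mul_assoc matrix_mul_assoc vector_transpose_matrix)
    also have "\<dots> = y \<bullet> (?D *v y)"
      by (simp add: QQ)
    also have "\<dots> = (\<Sum>i\<in>UNIV. d i * (y $ i)\<^sup>2)"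
    proof -
      have "(?D *v y) $ i = d i * y $ i" for i
        by (simp add: matrix_vector_mult_def if_distrib[of "\<lambda>u. u * _"] cong: if_cong)
      then show ?thesis
        by (simp add: inner_vec_def power2_eq_square mult_ac)
    qed
    finally show ?thesis .
  qed
  \<comment> \<open>\<open>d k\<close> is the squared length of the image under \<open>X\<close> of
    the \<open>k\<close>-th column of \<open>Q\<close>, and full column rank makes \<open>X\<close>
    injective.\<close>
  have pos: "0 < d k" for k
  proof -
    have "X *v (Q *v axis k 1) \<noteq> 0"
    proof
      assume "X *v (Q *v axis k 1) = 0"
      then have "Q *v axis k 1 = 0"
        using assms full_rank_injective[of X] injD[of "(*v) X" "Q *v axis k 1" 0] by simp
      then have "axis k 1 = (0 :: real ^ 'r)"
        using matrix_vector_mul_assoc[of "transpose Q" Q "axis k 1"]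
        by (simp only: QQ matrix_vector_mul_lid matrix_vector_mult_0_right)
      then show False
        by simp
    qed
    then have "0 < (norm (X *v (Q *v axis k 1)))\<^sup>2"
      by simp
    also have "\<dots> = d k"
      unfolding expand by (simp add: axis_def if_distrib[of "\<lambda>u. u\<^sup>2"]
          if_distrib[of "\<lambda>u. _ * u"] cong: if_cong)
    finally show ?thesis .
  qed
  then have Min_pos: "0 < Min (range d)"
    by simp
  then have sq: "(singular_value CARD('r) X)\<^sup>2 = Min (range d)"
    by (simp only: sv real_sqrt_pow2 less_imp_le)
  show "0 < (singular_value CARD('r) X)\<^sup>2"
    using Min_pos sq by simp
  define y where "y = transpose Q *v x"
  have x: "x = Q *v y"
    by (simp only: y_def matrix_vector_mul_assoc QQ matrix_vector_mul_lid)
  have "(norm x)\<^sup>2 = (norm y)\<^sup>2"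
    unfolding x norm_matrix_vector_mult_sq QQ by (simp add: power2_norm_eq_inner)
  then have "Min (range d) * (norm x)\<^sup>2 = (\<Sum>i\<in>UNIV. Min (range d) * (y $ i)\<^sup>2)"
    by (simp add: norm_vec_sq sum_distrib_left)
  also have "\<dots> \<le> (\<Sum>i\<in>UNIV. d i * (y $ i)\<^sup>2)"
    by (intro sum_mono mult_right_mono) auto
  finally show "(singular_value CARD('r) X)\<^sup>2 * (norm x)\<^sup>2 \<le> (norm (X *v x))\<^sup>2"
    by (simp add: sq x expand)
qed

section \<open>The Frobenius inner product\<close>

lemma inner_transpose: "transpose A \<bullet> transpose B = A \<bullet> (B :: real ^ 'n ^ 'm)"
  unfolding inner_vec_def[where 'b = 'm] inner_vec_def[where 'b = 'n] transpose_def
  by (simp, rule sum.swap)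

lemma norm_transpose_matrix: "norm (transpose A) = norm (A :: real ^ 'n ^ 'm)"
  by (simp add: norm_eq_sqrt_inner inner_transpose)

lemma inner_matrix_mult_right:
  fixes A :: "real ^ 'k ^ 'm" and B :: "real ^ 'n ^ 'k"
  shows "(A ** B) \<bullet> C = A \<bullet> (C ** transpose B)"
proof -
  have "(\<Sum>j\<in>UNIV. (\<Sum>k\<in>UNIV. A $ i $ k * B $ k $ j) * C $ i $ j)
      = (\<Sum>k\<in>UNIV. A $ i $ k * (\<Sum>j\<in>UNIV. C $ i $ j * B $ k $ j))" for i
    unfolding sum_distrib_left sum_distrib_right by (subst sum.swap) (simp add: mult_ac)
  then show ?thesis
    by (simp add: inner_vec_def matrix_matrix_mult_def transpose_def)
qed

lemma inner_matrix_mult_left: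
  fixes A :: "real ^ 'k ^ 'm" and B :: "real ^ 'n ^ 'k"
  shows "(A ** B) \<bullet> C = B \<bullet> (transpose A ** C)"
proof -
  have "(A ** B) \<bullet> C = (transpose B ** transpose A) \<bullet> transpose C"
    by (metis inner_transpose matrix_transpose_mul)
  also have "\<dots> = transpose B \<bullet> transpose (transpose A ** C)"
    by (simp add: inner_matrix_mult_right matrix_transpose_mul)
  finally show ?thesis
    by (simp add: inner_transpose)
qed

lemma norm_matrix_sq_rows: "(norm (A :: real ^ 'n ^ 'm))\<^sup>2 = (\<Sum>i\<in>UNIV. (norm (A $ i))\<^sup>2)"
  by (simp add: power2_norm_eq_inner inner_vec_def)

lemma norm_mult_transpose_sq:
  fixes A :: "real ^ 'r ^ 'm" and B :: "real ^ 'r ^ 'n"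
  shows "(norm (A ** transpose B))\<^sup>2 = (\<Sum>i\<in>UNIV. (norm (B *v A $ i))\<^sup>2)"
proof -
  have "(A ** transpose B) $ i = B *v A $ i" for i
    by (simp add: vec_eq_iff matrix_matrix_mult_def matrix_vector_mult_def transpose_def mult_ac)
  then show ?thesis
    by (simp add: norm_matrix_sq_rows)
qed

text \<open>The rows of \<open>A ** transpose B\<close> are the images under \<open>B\<close> of the
  rows of \<open>A\<close>, so the vector bound is summed over rows.\<close>

lemma singular_value_mult_transpose_bound:
  fixes A :: "real ^ 'r ^ 'm" and B :: "real ^ 'r ^ 'n"
  assumes "rank B = CARD('r)"
  shows "(singular_value CARD('r) B)\<^sup>2 * (norm A)\<^sup>2 \<le> (norm (A ** transpose B))\<^sup>2"
  unfolding norm_mult_transpose_sq norm_matrix_sq_rows[of A] sum_distrib_left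
  by (intro sum_mono singular_value_bound_pos assms)

text \<open>The entries of the Gram matrix are inner products of columns of \<open>A\<close>.
  Cauchy-Schwarz bounds each square, and the resulting double sum factors.\<close>

lemma norm_gram_le: "norm (transpose A ** A) \<le> (norm (A :: real ^ 'n ^ 'm))\<^sup>2"
proof -
  let ?T = "transpose A"
  have "(norm (?T ** transpose ?T))\<^sup>2 = (\<Sum>i\<in>UNIV. \<Sum>j\<in>UNIV. (?T $ j \<bullet> ?T $ i)\<^sup>2)"
  proof -
    have "(norm (?T *v x))\<^sup>2 = (\<Sum>j\<in>UNIV. (?T $ j \<bullet> x)\<^sup>2)" for x
      by (simp add: norm_vec_sq matrix_vector_mul_component del: transpose_matrix_vector)
    then show ?thesis
      by (simp only: norm_mult_transpose_sq)
  qed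
  also have "\<dots> \<le> (\<Sum>i\<in>UNIV. \<Sum>j\<in>UNIV. (norm (?T $ j))\<^sup>2 * (norm (?T $ i))\<^sup>2)"
    by (intro sum_mono) (simp add: Cauchy_Schwarz_ineq power2_norm_eq_inner)
  also have "\<dots> = ((norm ?T)\<^sup>2)\<^sup>2"
    unfolding norm_matrix_sq_rows power2_eq_square[of "sum _ _"] sum_product by (simp add: mult_ac)
  finally have "norm (?T ** A) \<le> (norm ?T)\<^sup>2"
    by (simp add: power2_le_imp_le)
  then show ?thesis
    by (simp add: norm_transpose_matrix)
qed

section \<open>Subadditivity of the rank and bilinearity of matrix operations\<close>

lemma rank_add_le: "rank (A + B) \<le> rank A + rank (B :: real ^ 'n ^ 'm)"
proof -
  let ?R = "\<lambda>M :: real ^ 'n ^ 'm. range ((*v) M)"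
  have sub: "subspace (?R M)" for M
    by (intro linear_subspace_image) auto
  \<comment> \<open>The column space of a sum lies in the sum of the column spaces.\<close>
  have "dim (?R (A + B)) \<le> dim {x + y |x y. x \<in> ?R A \<and> y \<in> ?R B}"
    by (intro dim_subset) (auto simp: matrix_vector_mult_add_rdistrib)
  also have "\<dots> \<le> dim (?R A) + dim (?R B)"
    using dim_sums_Int[OF sub sub, of A B] by simp
  finally show ?thesis
    by (simp add: rank_dim_range)
qed

lemma transpose_diff: "transpose (A - B) = transpose A - transpose (B :: 'a::ab_group_add ^ 'n ^ 'm)"
  by (simp add: transpose_def vec_eq_iff)

lemma transpose_add: "transpose (A + B) = transpose A + transpose (B :: 'a::ab_group_add ^ 'n ^ 'm)"
  by (simp add: transpose_def vec_eq_iff)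

lemma matrix_mult_diff_right: "A ** (B - C) = A ** B - A ** (C :: real ^ 'n ^ 'k)"
  by (simp add: vec_eq_iff matrix_matrix_mult_def algebra_simps sum_subtractf)

lemma matrix_mult_add_left: "(A + B) ** C = A ** C + B ** (C :: real ^ 'n ^ 'k)"
  by (simp add: vec_eq_iff matrix_matrix_mult_def algebra_simps sum.distrib)

lemma matrix_mult_scaleR_right: "A ** (c *\<^sub>R B) = c *\<^sub>R (A ** (B :: real ^ 'n ^ 'k))"
  by (simp add: vec_eq_iff matrix_matrix_mult_def sum_distrib_left mult_ac)

lemma matrix_mult_scaleR_left: "(c *\<^sub>R A) ** B = c *\<^sub>R (A ** (B :: real ^ 'n ^ 'k))"
  by (simp add: vec_eq_iff matrix_matrix_mult_def sum_distrib_left mult_ac)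

section \<open>Optimality conditions of the least squares step\<close>

text \<open>Optimality along the single line through 0 and \<open>w\<close> already makes the
  residual \<open>c + f w\<close> orthogonal to \<open>f w\<close>; Pythagoras gives the
  bound.\<close>

lemma least_squares_residual_bound:
  fixes f :: "'a::real_vector \<Rightarrow> 'b::real_inner"
  assumes f: "linear f" and min: "\<And>t. (norm (c + f w))\<^sup>2 \<le> (norm (c + f ((1 + t) *\<^sub>R w)))\<^sup>2"
  shows "(norm (f w))\<^sup>2 \<le> (norm c)\<^sup>2"
proof -
  have "0 \<le> 2 * t * ((c + f w) \<bullet> f w) + t\<^sup>2 * (f w \<bullet> f w)" for t
  proof -
    have "c + f ((1 + t) *\<^sub>R w) = (c + f w) + t *\<^sub>R f w"
      by (subst linear_scale[OF f]) (simp add: scaleR_left_distrib)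
    then have "(norm (c + f w))\<^sup>2 \<le> (norm ((c + f w) + t *\<^sub>R f w))\<^sup>2"
      using min[of t] by (simp only:)
    then show ?thesis
      unfolding norm_add_scaleR_sq by (simp add: power2_norm_eq_inner)
  qed
  then have "(c + f w) \<bullet> f w = 0"
    by (rule linear_coeff_zero_if_quadratic_nonneg)
  then have "(norm c)\<^sup>2 = (norm (c + f w))\<^sup>2 + (norm (f w))\<^sup>2"
    by (simp add: power2_norm_eq_inner inner_add_left inner_add_right algebra_simps inner_commute)
  then show ?thesis
    by simp
qed

lemma min_norm_lsq_solution_balanced:
  assumes "min_norm_lsq_solution \<A> b U V (\<Delta>U, \<Delta>V)"
  shows "transpose U ** \<Delta>U = transpose \<Delta>V ** V"
proof -
  \<comment> \<open>Choosing the direction \<open>W\<close> as the defect itself turns the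
    first-order change of the squared norm into \<open>W \<bullet> W\<close>.\<close>
  define W where "W = transpose U ** \<Delta>U - transpose \<Delta>V ** V"
  let ?u = "U ** W" and ?v = "V ** transpose W"
  have min: "is_arg_min (lsq_objective \<A> b U V) (\<lambda>_. True) (\<Delta>U, \<Delta>V)"
    and least: "\<And>y. is_arg_min (lsq_objective \<A> b U V) (\<lambda>_. True) y \<Longrightarrow>
      \<not> (case y of (\<Delta>U, \<Delta>V) \<Rightarrow> (norm \<Delta>U)\<^sup>2 + (norm \<Delta>V)\<^sup>2)
        < (case (\<Delta>U, \<Delta>V) of (\<Delta>U, \<Delta>V) \<Rightarrow> (norm \<Delta>U)\<^sup>2 + (norm \<Delta>V)\<^sup>2)"
    using assms unfolding min_norm_lsq_solution_def is_arg_min_def by blast+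
  have "0 \<le> 2 * t * (\<Delta>U \<bullet> ?u - \<Delta>V \<bullet> ?v) + t\<^sup>2 * ((norm ?u)\<^sup>2 + (norm ?v)\<^sup>2)" for t
  proof -
    have "lsq_objective \<A> b U V (\<Delta>U + t *\<^sub>R ?u, \<Delta>V - t *\<^sub>R ?v) = lsq_objective \<A> b U V (\<Delta>U, \<Delta>V)"
    proof -
      \<comment> \<open>The two contributions of the perturbation are plus and minus
        \<open>t\<close> times \<open>U ** W ** transpose V\<close>. The perturbed pair is therefore
        again a least squares minimiser and competes for the smallest norm.\<close>
      have "U ** transpose (\<Delta>V - t *\<^sub>R ?v) + (\<Delta>U + t *\<^sub>R ?u) ** transpose V
          = U ** transpose \<Delta>V + \<Delta>U ** transpose V"
        by (simp add: transpose_diff transpose_scalar matrix_mult_diff_right matrix_mult_add_left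
            matrix_mult_scaleR_left matrix_mult_scaleR_right matrix_transpose_mul matrix_mul_assoc)
      then show ?thesis
        by (simp add: lsq_objective_def add.assoc)
    qed
    then have "(norm \<Delta>U)\<^sup>2 + (norm \<Delta>V)\<^sup>2 \<le> (norm (\<Delta>U + t *\<^sub>R ?u))\<^sup>2 + (norm (\<Delta>V - t *\<^sub>R ?v))\<^sup>2"
      using least[of "(\<Delta>U + t *\<^sub>R ?u, \<Delta>V - t *\<^sub>R ?v)"] min by (simp add: is_arg_min_def not_less)
    then show ?thesis
      using norm_add_scaleR_sq[of \<Delta>U t ?u] norm_add_scaleR_sq[of \<Delta>V "- t" ?v]
      by (simp add: algebra_simps)
  qed
  then have "\<Delta>U \<bullet> ?u - \<Delta>V \<bullet> ?v = 0"
    by (rule linear_coeff_zero_if_quadratic_nonneg)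
  moreover have "\<Delta>U \<bullet> ?u = W \<bullet> (transpose U ** \<Delta>U)"
    by (simp add: inner_commute[of \<Delta>U] inner_matrix_mult_left)
  moreover have "\<Delta>V \<bullet> ?v = W \<bullet> (transpose \<Delta>V ** V)"
    using inner_transpose[of W "transpose \<Delta>V ** V"]
    by (simp add: inner_commute[of \<Delta>V] inner_matrix_mult_left matrix_transpose_mul)
  ultimately have "W \<bullet> W = 0"
    by (simp add: W_def inner_diff_right)
  then show ?thesis
    by (simp add: W_def)
qed

section \<open>From the optimality conditions and the RIP to the imbalance bound\<close>

theorem lemma4p3:
  fixes Xstar :: "real ^ 'n2 ^ 'n1"
    and \<A> :: "real ^ 'n2 ^ 'n1 \<Rightarrow> real ^ 'm"
    and b :: "real ^ 'm"
    and \<delta> :: real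
    and U\<^sub>t \<Delta>U U\<^sub>t' :: "real ^ 'r ^ 'n1"
    and V\<^sub>t \<Delta>V V\<^sub>t' :: "real ^ 'r ^ 'n2"
    and X\<^sub>t :: "real ^ 'n2 ^ 'n1"
  assumes rank_Xstar: "rank Xstar = CARD('r)"
    and linear: "linear \<A>"
    and RIP: "RIP (2 * CARD('r)) \<delta> \<A>"
    and b: "b = \<A> Xstar"
    and rank_U: "rank U\<^sub>t = CARD('r)"
    and rank_V: "rank V\<^sub>t = CARD('r)"
    and X: "X\<^sub>t = U\<^sub>t ** transpose V\<^sub>t"
    and step: "min_norm_lsq_solution \<A> b U\<^sub>t V\<^sub>t (\<Delta>U, \<Delta>V)"
    and U': "U\<^sub>t' = U\<^sub>t + \<Delta>U"
    and V': "V\<^sub>t' = V\<^sub>t + \<Delta>V"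
  shows "norm (transpose U\<^sub>t' ** U\<^sub>t' - transpose V\<^sub>t' ** V\<^sub>t')
    \<le> norm (transpose U\<^sub>t ** U\<^sub>t - transpose V\<^sub>t ** V\<^sub>t)
      + (1 + \<delta>) / (1 - \<delta>) *
        ((norm (X\<^sub>t - Xstar))\<^sup>2
          / min ((singular_value CARD('r) U\<^sub>t)\<^sup>2) ((singular_value CARD('r) V\<^sub>t)\<^sup>2))"
proof -
  define s where "s = min ((singular_value CARD('r) U\<^sub>t)\<^sup>2) ((singular_value CARD('r) V\<^sub>t)\<^sup>2)"
  define L where "L = U\<^sub>t ** transpose \<Delta>V + \<Delta>U ** transpose V\<^sub>t"
  define M where "M = transpose U\<^sub>t ** \<Delta>U"
  have M': "M = transpose \<Delta>V ** V\<^sub>t"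
    using min_norm_lsq_solution_balanced[OF step] by (simp add: M_def)
  have \<delta>: "0 \<le> \<delta>" "\<delta> < 1"
    and RIP_bounds: "\<And>Y. rank Y \<le> 2 * CARD('r) \<Longrightarrow>
      (1 - \<delta>) * (norm Y)\<^sup>2 \<le> (norm (\<A> Y))\<^sup>2 \<and> (norm (\<A> Y))\<^sup>2 \<le> (1 + \<delta>) * (norm Y)\<^sup>2"
    using RIP by (auto simp: RIP_def)
  have s_pos: "0 < s"
    using singular_value_bound_pos(1)[OF rank_U] singular_value_bound_pos(1)[OF rank_V]
    by (simp add: s_def)

  have "(norm (\<A> L))\<^sup>2 \<le> (norm (\<A> X\<^sub>t - b))\<^sup>2"
  proof (rule least_squares_residual_bound[OF linear])
    fix t
    \<comment> \<open>Scaling \<open>L\<close> amounts to scaling both increments, so the scaled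
      \<open>L\<close> comes from another candidate of the least squares problem.\<close>
    have "(1 + t) *\<^sub>R L
        = U\<^sub>t ** transpose ((1 + t) *\<^sub>R \<Delta>V) + ((1 + t) *\<^sub>R \<Delta>U) ** transpose V\<^sub>t"
      by (simp add: L_def transpose_scalar scaleR_right_distrib
          matrix_mult_scaleR_left matrix_mult_scaleR_right)
    moreover have "lsq_objective \<A> b U\<^sub>t V\<^sub>t (\<Delta>U, \<Delta>V)
        \<le> lsq_objective \<A> b U\<^sub>t V\<^sub>t ((1 + t) *\<^sub>R \<Delta>U, (1 + t) *\<^sub>R \<Delta>V)"
      using step by (auto simp: min_norm_lsq_solution_def is_arg_min_def not_less)
    ultimately show "(norm (\<A> X\<^sub>t - b + \<A> L))\<^sup>2 \<le> (norm (\<A> X\<^sub>t - b + \<A> ((1 + t) *\<^sub>R L)))\<^sup>2"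
      by (simp add: lsq_objective_def X L_def add.assoc linear_add[OF linear] algebra_simps)
  qed
  also have "\<A> X\<^sub>t - b = \<A> (X\<^sub>t - Xstar)"
    by (simp add: b linear_diff[OF linear])
  also have "(norm \<dots>)\<^sup>2 \<le> (1 + \<delta>) * (norm (X\<^sub>t - Xstar))\<^sup>2"
  proof -
    have "rank (X\<^sub>t - Xstar) \<le> rank X\<^sub>t + rank (- Xstar)"
      using rank_add_le[of X\<^sub>t "- Xstar"] by simp
    also have "rank (- Xstar) \<le> CARD('r)"
      \<comment> \<open>\<open>- Xstar\<close> is written as \<open>Xstar ** (- mat 1)\<close> so
        that the rank bound for products applies.\<close>
      using rank_mul_le_left[of Xstar "- mat 1"] rank_Xstar matrix_mult_diff_right[of Xstar 0 "mat 1"]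
      by simp
    also have "rank X\<^sub>t \<le> CARD('r)"
      using rank_mul_le_left[of U\<^sub>t "transpose V\<^sub>t"] rank_U X by simp
    finally show ?thesis
      using RIP_bounds by simp
  qed
  finally have AL: "(norm (\<A> L))\<^sup>2 \<le> (1 + \<delta>) * (norm (X\<^sub>t - Xstar))\<^sup>2" .

  \<comment> \<open>Each summand of \<open>L\<close> has a factor of rank \<open>CARD('r)\<close>,
    which brings \<open>L\<close> within reach of the lower RIP bound.\<close>
  have "rank L \<le> 2 * CARD('r)"
    using rank_add_le[of "U\<^sub>t ** transpose \<Delta>V" "\<Delta>U ** transpose V\<^sub>t"]
      rank_mul_le_left[of U\<^sub>t "transpose \<Delta>V"] rank_mul_le_right[of \<Delta>U "transpose V\<^sub>t"]
    by (simp add: L_def rank_U rank_V rank_transpose)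
  then have L_bound: "(1 - \<delta>) * (norm L)\<^sup>2 \<le> (1 + \<delta>) * (norm (X\<^sub>t - Xstar))\<^sup>2"
    using RIP_bounds AL by fastforce

  \<comment> \<open>Moving \<open>U\<^sub>t\<close> and \<open>transpose V\<^sub>t\<close> across
    the inner product yields both expressions for \<open>M\<close>, which agree by the balance
    identity.\<close>
  have cross: "(U\<^sub>t ** transpose \<Delta>V) \<bullet> (\<Delta>U ** transpose V\<^sub>t) = (norm M)\<^sup>2"
  proof -
    have "(U\<^sub>t ** transpose \<Delta>V) \<bullet> (\<Delta>U ** transpose V\<^sub>t)
        = (M ** transpose V\<^sub>t) \<bullet> transpose \<Delta>V"
      by (simp add: inner_matrix_mult_left M_def matrix_mul_assoc inner_commute)
    also have "\<dots> = M \<bullet> (transpose \<Delta>V ** V\<^sub>t)"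
      by (simp add: inner_matrix_mult_right)
    finally show ?thesis
      by (simp add: M'[symmetric] power2_norm_eq_inner)
  qed
  \<comment> \<open>The singular values are paired crosswise, since \<open>\<Delta>U\<close> is
    multiplied by \<open>V\<^sub>t\<close> and \<open>\<Delta>V\<close> by \<open>U\<^sub>t\<close>;
    \<open>s\<close> is below both.\<close>
  have "s * ((norm \<Delta>U)\<^sup>2 + (norm \<Delta>V)\<^sup>2)
      \<le> (singular_value CARD('r) V\<^sub>t)\<^sup>2 * (norm \<Delta>U)\<^sup>2 + (singular_value CARD('r) U\<^sub>t)\<^sup>2 * (norm \<Delta>V)\<^sup>2"
    unfolding distrib_left s_def by (intro add_mono mult_right_mono) auto
  also have "\<dots> \<le> (norm (\<Delta>U ** transpose V\<^sub>t))\<^sup>2 + (norm (\<Delta>V ** transpose U\<^sub>t))\<^sup>2"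
    by (intro add_mono singular_value_mult_transpose_bound rank_U rank_V)
  also have "\<Delta>V ** transpose U\<^sub>t = transpose (U\<^sub>t ** transpose \<Delta>V)"
    by (simp add: matrix_transpose_mul)
  \<comment> \<open>Expanding the square of \<open>L\<close> adds twice the cross term, which is
    nonnegative.\<close>
  also have "(norm (\<Delta>U ** transpose V\<^sub>t))\<^sup>2 + (norm \<dots>)\<^sup>2 \<le> (norm L)\<^sup>2"
    unfolding L_def norm_transpose_matrix using cross
    by (simp add: power2_norm_eq_inner inner_add_left inner_add_right inner_commute)
  finally have "(1 - \<delta>) * (s * ((norm \<Delta>U)\<^sup>2 + (norm \<Delta>V)\<^sup>2)) \<le> (1 - \<delta>) * (norm L)\<^sup>2"
    using \<delta> by (intro mult_left_mono) auto
  also note L_bound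
  finally have *: "(1 - \<delta>) * (s * ((norm \<Delta>U)\<^sup>2 + (norm \<Delta>V)\<^sup>2))
      \<le> (1 + \<delta>) * (norm (X\<^sub>t - Xstar))\<^sup>2" .
  have step_bound: "(norm \<Delta>U)\<^sup>2 + (norm \<Delta>V)\<^sup>2
      \<le> (1 + \<delta>) / (1 - \<delta>) * ((norm (X\<^sub>t - Xstar))\<^sup>2 / s)"
  proof -
    have "0 < (1 - \<delta>) * s"
      using \<delta> s_pos by simp
    then have "(norm \<Delta>U)\<^sup>2 + (norm \<Delta>V)\<^sup>2
        \<le> (1 + \<delta>) * (norm (X\<^sub>t - Xstar))\<^sup>2 / ((1 - \<delta>) * s)"
      using * by (simp add: pos_le_divide_eq mult_ac)
    then show ?thesis
      by simp
  qed

  \<comment> \<open>Both Gram matrices acquire the same first-order part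
    \<open>M + transpose M\<close>, which cancels in the difference.\<close>
  have "transpose U\<^sub>t' ** U\<^sub>t' - transpose V\<^sub>t' ** V\<^sub>t'
      = (transpose U\<^sub>t ** U\<^sub>t - transpose V\<^sub>t ** V\<^sub>t)
        + (transpose \<Delta>U ** \<Delta>U - transpose \<Delta>V ** \<Delta>V)"
  proof -
    have "transpose \<Delta>U ** U\<^sub>t = transpose M" "transpose V\<^sub>t ** \<Delta>V = transpose M"
      by (simp add: M_def matrix_transpose_mul) (simp add: M' matrix_transpose_mul)
    then show ?thesis
      by (simp add: U' V' transpose_add matrix_add_ldistrib matrix_mult_add_left
          flip: M_def M')
  qed
  then have "norm (transpose U\<^sub>t' ** U\<^sub>t' - transpose V\<^sub>t' ** V\<^sub>t')
      \<le> norm (transpose U\<^sub>t ** U\<^sub>t - transpose V\<^sub>t ** V\<^sub>t)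
        + (norm (transpose \<Delta>U ** \<Delta>U) + norm (transpose \<Delta>V ** \<Delta>V))"
    by (simp only: norm_triangle_mono norm_triangle_ineq4 order_refl)
  also have "\<dots> \<le> norm (transpose U\<^sub>t ** U\<^sub>t - transpose V\<^sub>t ** V\<^sub>t)
        + ((norm \<Delta>U)\<^sup>2 + (norm \<Delta>V)\<^sup>2)"
    by (intro add_left_mono add_mono norm_gram_le)
  also note step_bound
  finally show ?thesis
    by (simp only: s_def)
qed

end
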